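(* Let $(p_k)_{k\in\mathbb{N}}$ be a probability sequence and let $\rho\geq 1$. Suppose that $(p_k)_{k\in\mathbb{N}}$ is regularly varying with tail index $\rho$. Then: (i) for any $0<\beta<1$ and $c>0$, $$\dim\left\{x\in[0,1):\lim_{n\to+\infty}\frac{D_n(x)}{n^\beta}=c\right\}=1;$$ (ii) $$\dim\left\{x\in[0,1):\lim_{n\to+\infty}\frac{D_n(x)}{n}=0\right\}=1.$$
   Context: $\mathbb{N}=\{1,2,3,\ldots\}$, $\mathbb{R}^+=(0,\infty)$, and $\dim$ denotes Hausdorff dimension. A probability sequence is a sequence $(p_k)_{k\in\mathbb{N}}$ with $p_k>0$ for every $k$ and $\sum_{k\in\mathbb{N}}p_k=1$. It is regularly varying with tail index $\rho\geq1$ if there exists a slowly varying function $L:\mathbb{N}\to\mathbb{R}^+$ (i.e. $\lim_{k\to\infty}L(\lfloor\lambda k\rfloor)/L(k)=1$ for every $\lambda>0$) such that $\lim_{k\to+\infty}p_k/(k^{-\rho}L(k))=1$. Setting: $(I_k)_{k\in\mathbb{N}}$ is a partition of $[0,1)$ into pairwise disjoint half-open intervals (of the form $[a,b)$) with $\operatorname{diam} I_k=p_k$ for every $k$. The full-branch map $T:[0,1)\to[0,1)$ is $T(x)=(x-\inf I_k)/p_k$ for $x\in I_k$. For $n\in\mathbb{N}$, the digit function $d_n:[0,1)\to\mathbb{N}$ is defined by $d_n(x)=k$ if $T^{n-1}(x)\in I_k$. The distinct-digit count is $D_n(x)=\#\{d_1(x),\ldots,d_n(x)\}$. *)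

theory Defs
  imports "HOL-Analysis.Analysis"
begin

section \<open>Hausdorff measure and Hausdorff dimension\<close>

text \<open>The library function \<^const>\<open>diameter\<close> is real-valued and only meaningful on bounded sets, hence
  the boundedness requirement on covers below. The case distinction implements the conventions
  \<open>(diam {})^s = 0\<close> for every \<open>s\<close> and \<open>(diam U)^0 = 1\<close> for nonempty \<open>U\<close>; note that \<^const>\<open>powr\<close>
  has \<open>0 powr 0 = 0\<close>.\<close>

definition hausdorff_gauge :: "real \<Rightarrow> 'a::metric_space set \<Rightarrow> ennreal" where
  "hausdorff_gauge s U =
     (if U = {} then 0 else if s = 0 then 1 else ennreal (diameter U powr s))"

definition delta_covers :: "real \<Rightarrow> 'a::metric_space set \<Rightarrow> (nat \<Rightarrow> 'a set) set" where
  "delta_covers \<delta> A =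
     {U. A \<subseteq> (\<Union>i. U i) \<and> (\<forall>i. bounded (U i) \<and> diameter (U i) \<le> \<delta>)}"

definition hausdorff_premeasure :: "real \<Rightarrow> real \<Rightarrow> 'a::metric_space set \<Rightarrow> ennreal" where
  "hausdorff_premeasure s \<delta> A = (INF U \<in> delta_covers \<delta> A. \<Sum>i. hausdorff_gauge s (U i))"

definition hausdorff_measure :: "real \<Rightarrow> 'a::metric_space set \<Rightarrow> ennreal" where
  "hausdorff_measure s A = (SUP \<delta> \<in> {0<..}. hausdorff_premeasure s \<delta> A)"

definition hausdorff_dim :: "'a::metric_space set \<Rightarrow> ereal" where
  "hausdorff_dim A = (INF s \<in> {s. 0 \<le> s \<and> hausdorff_measure s A = 0}. ereal s)"


section \<open>Regularly varying probability sequences\<close>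

text \<open>Sequences indexed by the positive integers are functions on \<^typ>\<open>nat\<close> whose value at \<open>0\<close>
  is irrelevant.\<close>

definition probability_sequence :: "(nat \<Rightarrow> real) \<Rightarrow> bool" where
  "probability_sequence p \<longleftrightarrow> (\<forall>k\<ge>1. p k > 0) \<and> (p has_sum 1) {1..}"

definition slowly_varying :: "(nat \<Rightarrow> real) \<Rightarrow> bool" where
  "slowly_varying L \<longleftrightarrow> (\<forall>k\<ge>1. L k > 0) \<and>
     (\<forall>t::real. t > 0 \<longrightarrow> (\<lambda>k. L (nat \<lfloor>t * real k\<rfloor>) / L k) \<longlonglongrightarrow> 1)"

definition regularly_varying :: "(nat \<Rightarrow> real) \<Rightarrow> real \<Rightarrow> bool" where
  "regularly_varying p \<rho> \<longleftrightarrow>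
     (\<exists>L. slowly_varying L \<and> (\<lambda>k. p k / (real k powr (- \<rho>) * L k)) \<longlonglongrightarrow> 1)"


section \<open>Full-branch maps and digits\<close>

definition interval_partition :: "(nat \<Rightarrow> real) \<Rightarrow> (nat \<Rightarrow> real set) \<Rightarrow> bool" where
  "interval_partition p I \<longleftrightarrow>
     (\<forall>k\<ge>1. (\<exists>a b. I k = {a..<b}) \<and> diameter (I k) = p k) \<and>
     disjoint_family_on I {1..} \<and> (\<Union>k\<in>{1..}. I k) = {0..<1}"

definition branch_index :: "(nat \<Rightarrow> real set) \<Rightarrow> real \<Rightarrow> nat" where
  "branch_index I x = (THE k. k \<ge> 1 \<and> x \<in> I k)"

definition full_branch_map :: "(nat \<Rightarrow> real) \<Rightarrow> (nat \<Rightarrow> real set) \<Rightarrow> real \<Rightarrow> real" where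
  "full_branch_map p I x = (let k = branch_index I x in (x - Inf (I k)) / p k)"

definition digit :: "(nat \<Rightarrow> real) \<Rightarrow> (nat \<Rightarrow> real set) \<Rightarrow> nat \<Rightarrow> real \<Rightarrow> nat" where
  "digit p I n x = branch_index I ((full_branch_map p I ^^ (n - 1)) x)"

definition distinct_digits :: "(nat \<Rightarrow> real) \<Rightarrow> (nat \<Rightarrow> real set) \<Rightarrow> nat \<Rightarrow> real \<Rightarrow> nat" where
  "distinct_digits p I n x = card ((\<lambda>i. digit p I i x) ` {1..n})"

end

theory Submission
  imports Defs "HOL-Library.Sublist" "HOL-Real_Asymp.Real_Asymp"
begin

text \<open>
Fix \<open>0 < s < 1\<close>. Since every \<open>p a\<close> is smaller than 1 and the \<open>p a\<close> sum to 1, the powers \<open>p a powr s\<close>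
with \<open>a \<le> N\<close> have a sum \<open>Z > 1\<close> as soon as \<open>N\<close> is large. Choosing digits independently from
\<open>{1..N}\<close> with probabilities \<open>p a powr s / Z\<close> gives a cylinder of \<open>n\<close> digits a mass equal to
its length to the power \<open>s\<close>, divided by \<open>Z ^ n\<close>. The exponentially small factor is room to spare: it
allows a sparse set of positions to be sacrificed without the dimension dropping below \<open>s\<close>.

At these positions new digits \<open>N + 1, N + 2, \<dots>\<close> are planted, each one once, in such a way that the
number \<open>J n\<close> of planted positions among the first \<open>n\<close> satisfies \<open>J n / n powr \<beta> \<longlonglongrightarrow> c\<close>. The free
positions contribute at most \<open>N\<close> digits, so the number of distinct digits lies between \<open>J n\<close> and
\<open>N + J n\<close> and has the prescribed growth. A planted digit \<open>a\<close> costs a factor \<open>1 / p a\<close> in the comparison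
of mass and length. Regular variation enters only here: it bounds \<open>p a\<close> from below by a power of \<open>a\<close>,
hence the first \<open>J n\<close> planted digits cost at most \<open>exp (O (n powr \<beta> * ln n))\<close>, which \<open>Z ^ n\<close>
outweighs because \<open>\<beta> < 1\<close>.

The passage from masses to Hausdorff measure is a mass distribution principle carried out on words
instead of points (\<open>hausdorff_measure_ne_0\<close>). A cover of the set is translated into a family of words,
namely those whose cylinder meets a covering set and has just become about as short as it. If the cover were
cheap, this family would have total mass below 1, and then some infinite digit sequence would avoid it
(\<open>branch_avoiding_light_set\<close>); the point with these digits would not be covered. As the cylinders are
half-open, nested ones may have empty intersection, but not along a sequence with infinitely many
distinct digits (\<open>point_with_digits\<close>), and planting makes every admissible sequence of this kind.

Growth like \<open>n powr (1/2)\<close> is in particular sublinear, which gives the second claim. The upper bound 1 holds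
for every subset of the unit interval.
\<close>

section \<open>Infinite sequences avoiding a light set of words\<close>

definition word_mass :: "(nat \<Rightarrow> nat \<Rightarrow> real) \<Rightarrow> nat list \<Rightarrow> real" where
  "word_mass q w = (\<Prod>i<length w. q i (w ! i))"

text \<open>
Not a probability measure: the words of each fixed length already have total mass 1. It serves to count a
set of words with weights, so that countable additivity is at hand.
\<close>

definition word_measure :: "(nat \<Rightarrow> nat \<Rightarrow> real) \<Rightarrow> nat list measure" where
  "word_measure q = density (count_space UNIV) (\<lambda>w. ennreal (word_mass q w))"

lemma word_mass_Nil [simp]: "word_mass q [] = 1"
  by (simp add: word_mass_def)

lemma word_mass_snoc: "word_mass q (v @ [a]) = word_mass q v * q (length v) a"
  by (simp add: word_mass_def nth_append)

lemma word_mass_nonneg: "(\<And>i a. 0 \<le> q i a) \<Longrightarrow> 0 \<le> word_mass q w"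
  by (simp add: word_mass_def prod_nonneg)

lemma sets_word_measure [simp]: "sets (word_measure q) = UNIV"
  by (simp add: word_measure_def)

lemma emeasure_word_measure:
  "emeasure (word_measure q) W = (\<integral>\<^sup>+ w. ennreal (word_mass q w) * indicator W w \<partial>count_space UNIV)"
  by (simp add: word_measure_def emeasure_density)

lemma emeasure_word_measure_ge:
  assumes "w \<in> W"
  shows "ennreal (word_mass q w) \<le> emeasure (word_measure q) W"
proof -
  have "ennreal (word_mass q w) = emeasure (word_measure q) {w}"
    by (simp add: emeasure_word_measure)
  also have "\<dots> \<le> emeasure (word_measure q) W"
    using assms by (intro emeasure_mono) auto
  finally show ?thesis .
qed

text \<open>
Think of \<open>q i\<close> as the distribution of the \<open>i\<close>-th digit. The total mass of the
words of \<open>W\<close> extending \<open>v\<close> is the sum over the next digit \<open>a\<close> of the same quantity for \<open>v @ [a]\<close>, plus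
the mass of \<open>v\<close> if \<open>v\<close> itself belongs to \<open>W\<close>; the mass of \<open>v\<close> is the sum of those of the \<open>v @ [a]\<close>.
So if \<open>W\<close> is too light to block \<open>v\<close>, it is too light to block some \<open>v @ [a]\<close>, and the
sequence is built digit by digit. This replaces the construction of the infinite product measure.
\<close>

lemma branch_avoiding_light_set:
  fixes q :: "nat \<Rightarrow> nat \<Rightarrow> real"
  assumes nonneg: "\<And>i a. 0 \<le> q i a"
    and total: "\<And>i. q i sums 1"
    and light: "emeasure (word_measure q) W < 1"
  obtains \<omega> :: "nat \<Rightarrow> nat"
  where "\<And>n. map \<omega> [0..<n] \<notin> W" and "\<And>n. 0 < q n (\<omega> n)"
proof -
  define f where "f v = emeasure (word_measure q) {w \<in> W. prefix v w}" for v
  define good where "good v \<longleftrightarrow> f v < ennreal (word_mass q v)" for v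
  have good_Nil: "good []"
    using light by (simp add: good_def f_def)
  have extend: "\<exists>a. good (v @ [a])" if "good v" for v
  proof (rule ccontr)
    assume "\<nexists>a. good (v @ [a])"
    then have le: "ennreal (word_mass q (v @ [a])) \<le> f (v @ [a])" for a
      by (auto simp: good_def not_less)
    have "(\<Sum>a. ennreal (word_mass q v * q (length v) a)) = ennreal (word_mass q v * 1)"
      using total[of "length v"] word_mass_nonneg[OF nonneg] nonneg
      by (intro suminf_ennreal_eq sums_mult) auto
    then have "ennreal (word_mass q v) = (\<Sum>a. ennreal (word_mass q (v @ [a])))"
      by (simp add: word_mass_snoc)
    also have "\<dots> \<le> (\<Sum>a. f (v @ [a]))"
      using le by (intro suminf_le) auto
    also have "\<dots> = emeasure (word_measure q) (\<Union>a. {w \<in> W. prefix (v @ [a]) w})"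
      unfolding f_def
      by (intro suminf_emeasure) (auto simp: disjoint_family_on_def prefix_def)
    also have "\<dots> \<le> f v"
      unfolding f_def by (intro emeasure_mono) (auto simp: prefix_def)
    finally show False
      using that by (simp add: good_def)
  qed
  define next_digit where "next_digit v = (SOME a. good (v @ [a]))" for v
  define V where "V = rec_nat [] (\<lambda>_ v. v @ [next_digit v])"
  define \<omega> where "\<omega> n = next_digit (V n)" for n
  have V_0: "V 0 = []" and V_Suc: "V (Suc n) = V n @ [\<omega> n]" for n
    by (simp_all add: V_def \<omega>_def)
  have good_V: "good (V n)" for n
  proof (induction n)
    case 0
    show ?case by (simp add: V_0 good_Nil)
  next
    case (Suc n)
    show ?case
      unfolding V_Suc \<omega>_def next_digit_def using extend[OF Suc.IH] by (rule someI_ex)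
  qed
  have map_\<omega>: "map \<omega> [0..<n] = V n" for n
    by (induction n) (simp_all add: V_0 V_Suc)
  show thesis
  proof
    show "map \<omega> [0..<n] \<notin> W" for n
    proof
      assume "map \<omega> [0..<n] \<in> W"
      then have "ennreal (word_mass q (V n)) \<le> f (V n)"
        unfolding f_def map_\<omega> by (intro emeasure_word_measure_ge) simp
      then show False
        using good_V[of n] by (simp add: good_def)
    qed
    show "0 < q n (\<omega> n)" for n
    proof -
      have "0 < word_mass q (V (Suc n))"
        using good_V[of "Suc n"] by (metis ennreal_less_zero_iff good_def le_less_trans zero_le)
      moreover have "length (V n) = n"
        by (induction n) (simp_all add: V_0 V_Suc)
      ultimately show ?thesis
        using nonneg[of n "\<omega> n"] by (auto simp: V_Suc word_mass_snoc zero_less_mult_iff)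
    qed
  qed
qed

section \<open>Hausdorff dimension in the unit interval\<close>

text \<open>
Covering by \<open>n\<close> intervals of length \<open>1 / n\<close> costs \<open>n powr (1 - s)\<close>.
\<close>

lemma hausdorff_measure_eq_0_unit_interval:
  fixes E :: "real set"
  assumes E: "E \<subseteq> {0..<1}" and s: "1 < s"
  shows "hausdorff_measure s E = 0"
proof -
  have "hausdorff_premeasure s \<delta> E = 0" if "0 < \<delta>" for \<delta>
  proof -
    define U where "U n i = (if i < n then {real i / real n .. (real i + 1) / real n} else {})"
      for n i :: nat
    have bound: "hausdorff_premeasure s \<delta> E \<le> ennreal (real n powr (1 - s))"
      if n: "n > 0" "1 / real n \<le> \<delta>" for n
    proof -
      have diam: "diameter (U n i) = (if i < n then 1 / real n else 0)" for i
        using n by (simp add: U_def divide_right_mono not_less add_divide_distrib)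
      have "x \<in> (\<Union>i. U n i)" if "x \<in> E" for x
      proof -
        have x: "0 \<le> x" "x < 1"
          using E that by auto
        define i where "i = nat \<lfloor>x * real n\<rfloor>"
        have i: "real i \<le> x * real n" "x * real n < real i + 1"
          using x by (simp_all add: i_def)
        moreover have "x * real n < real n"
          using x n by simp
        ultimately have "real i < real n"
          by linarith
        then have "x \<in> U n i"
          using i n by (simp add: U_def field_simps)
        then show ?thesis by blast
      qed
      moreover have "bounded (U n i)" for i
        by (simp add: U_def)
      ultimately have "U n \<in> delta_covers \<delta> E"
        using n \<open>0 < \<delta>\<close> by (auto simp: delta_covers_def diam)
      then have "hausdorff_premeasure s \<delta> E \<le> (\<Sum>i. hausdorff_gauge s (U n i))"
        unfolding hausdorff_premeasure_def by (rule INF_lower)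
      also have "\<dots> = (\<Sum>i<n. hausdorff_gauge s (U n i))"
        by (intro suminf_finite) (auto simp: hausdorff_gauge_def U_def)
      also have "\<dots> \<le> (\<Sum>i<n. ennreal (real n powr - s))"
        using s n by (intro sum_mono)
          (auto simp: hausdorff_gauge_def diam powr_minus_divide powr_divide)
      also have "\<dots> = ennreal (real n powr (1 - s))"
        using n by (simp add: ennreal_of_nat_eq_real_of_nat ennreal_mult[symmetric] powr_diff
            powr_minus field_simps)
      finally show ?thesis .
    qed
    have "(\<lambda>n. ennreal (real n powr (1 - s))) \<longlonglongrightarrow> ennreal 0"
      using s by (intro tendsto_ennrealI tendsto_neg_powr filterlim_real_sequentially) auto
    moreover have "eventually (\<lambda>n. n > 0 \<and> 1 / real n \<le> \<delta>) sequentially"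
    proof -
      have "eventually (\<lambda>n. 1 / real n < \<delta>) sequentially"
        using lim_1_over_n[where ?'a = real] \<open>0 < \<delta>\<close> by (rule order_tendstoD(2))
      then show ?thesis
        using eventually_gt_at_top[of 0] by eventually_elim auto
    qed
    ultimately have "hausdorff_premeasure s \<delta> E \<le> ennreal 0"
      by (intro tendsto_lowerbound[of _ "ennreal 0" sequentially])
        (auto elim!: eventually_mono intro: bound)
    then show ?thesis by simp
  qed
  then show ?thesis
    by (simp add: hausdorff_measure_def)
qed

lemma hausdorff_dim_le_1:
  fixes E :: "real set"
  assumes "E \<subseteq> {0..<1}"
  shows "hausdorff_dim E \<le> 1"
proof (rule ereal_le_epsilon2)
  fix e :: real
  assume "0 < e"
  then have "hausdorff_dim E \<le> ereal (1 + e)"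
    unfolding hausdorff_dim_def
    using hausdorff_measure_eq_0_unit_interval[OF assms, of "1 + e"] by (intro INF_lower) auto
  then show "hausdorff_dim E \<le> 1 + ereal e"
    by (simp add: one_ereal_def)
qed

section \<open>Cylinders of a full-branch map\<close>

text \<open>
Digits are positive and \<open>p 0\<close>, \<open>I 0\<close> are arbitrary; this is why words are required not to contain 0.
\<close>

locale full_branch_system =
  fixes p :: "nat \<Rightarrow> real" and I :: "nat \<Rightarrow> real set"
  assumes probability: "probability_sequence p"
    and partition: "interval_partition p I"
begin

definition offset :: "nat \<Rightarrow> real" where
  "offset a = Inf (I a)"

lemma p_pos: "a \<ge> 1 \<Longrightarrow> 0 < p a"
  using probability by (simp add: probability_sequence_def)

lemma I_eq:
  assumes "a \<ge> 1"
  shows "I a = {offset a..<offset a + p a}"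
proof -
  obtain l u where lu: "I a = {l..<u}" and diam: "diameter (I a) = p a"
    using partition assms by (auto simp: interval_partition_def)
  have "l < u"
  proof (rule ccontr)
    assume "\<not> l < u"
    then have "I a = {}" using lu by simp
    then show False using diam p_pos[OF assms] by simp
  qed
  have "diameter (closure {l..<u}) = diameter {l..<u}"
    by (rule diameter_closure) simp
  then have "p a = u - l"
    using \<open>l < u\<close> diam lu by simp
  then show ?thesis
    using \<open>l < u\<close> lu by (simp add: offset_def)
qed

lemma UN_I: "(\<Union>a\<in>{1..}. I a) = {0..<1}"
  using partition by (simp add: interval_partition_def)

lemma I_disjoint: "a \<ge> 1 \<Longrightarrow> b \<ge> 1 \<Longrightarrow> x \<in> I a \<Longrightarrow> x \<in> I b \<Longrightarrow> a = b"
  using partition unfolding interval_partition_def disjoint_family_on_def atLeast_iff by blast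

lemma I_bounds:
  assumes "a \<ge> 1"
  shows "0 \<le> offset a" "offset a + p a \<le> 1"
proof -
  have sub: "{offset a..<offset a + p a} \<subseteq> {0..<1}"
    using UN_I I_eq assms by blast
  then have "{offset a..<offset a + p a} \<subseteq> {0..1}"
    by force
  then show "0 \<le> offset a" "offset a + p a \<le> 1"
    using p_pos[OF assms] by (auto simp: atLeastLessThan_subseteq_atLeastAtMost_iff)
qed

lemma branch_index_eq: "a \<ge> 1 \<Longrightarrow> x \<in> I a \<Longrightarrow> branch_index I x = a"
  unfolding branch_index_def using I_disjoint by blast

lemma full_branch_map_eq: "a \<ge> 1 \<Longrightarrow> x \<in> I a \<Longrightarrow> full_branch_map p I x = (x - offset a) / p a"
  by (simp add: full_branch_map_def branch_index_eq offset_def)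

lemma sum_p_le_1: "finite A \<Longrightarrow> 0 \<notin> A \<Longrightarrow> sum p A \<le> 1"
  using probability p_pos
  by (intro finite_sum_le_has_sum[where A = "{1..}"])
    (auto simp: probability_sequence_def Suc_le_eq less_imp_le intro!: gr0I)

text \<open>
Any two of the \<open>p a\<close> sum to at most 1, so none exceeds \<open>1 - min (p 1) (p 2)\<close>. The uniform bound makes
the lengths of nested cylinders tend to 0.
\<close>

lemma p_le_contraction_rate:
  obtains \<theta> where "0 < \<theta>" and "\<theta> < 1" and "\<And>a. a \<ge> 1 \<Longrightarrow> p a \<le> \<theta>"
proof
  define \<theta> where "\<theta> = 1 - min (p 1) (p 2)"
  have 12: "0 < p 1" "0 < p 2" by (simp_all add: p_pos)
  have "p 1 + p 2 \<le> 1"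
    using sum_p_le_1[of "{1, 2}"] by simp
  then show "0 < \<theta>" using 12 by (auto simp: \<theta>_def)
  show "\<theta> < 1" using 12 by (auto simp: \<theta>_def)
  show "p a \<le> \<theta>" if "a \<ge> 1" for a
  proof (cases "a = 1")
    case True
    then show ?thesis using \<open>p 1 + p 2 \<le> 1\<close> by (auto simp: \<theta>_def)
  next
    case False
    then have "p a + p 1 \<le> 1" using sum_p_le_1[of "{a, 1}"] that by simp
    then show ?thesis by (auto simp: \<theta>_def)
  qed
qed

fun left_end :: "nat list \<Rightarrow> real" where
  "left_end [] = 0"
| "left_end (a # w) = offset a + p a * left_end w"

definition cyl_length :: "nat list \<Rightarrow> real" where
  "cyl_length w = prod_list (map p w)"

definition cylinder :: "nat list \<Rightarrow> real set" where
  "cylinder w = {left_end w..<left_end w + cyl_length w}"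

lemma cyl_length_simps [simp]:
  "cyl_length [] = 1"
  "cyl_length (a # w) = p a * cyl_length w"
  "cyl_length (v @ w) = cyl_length v * cyl_length w"
  by (simp_all add: cyl_length_def)

lemma left_end_append: "left_end (v @ w) = left_end v + cyl_length v * left_end w"
  by (induction v) (simp_all add: algebra_simps)

lemma cyl_length_pos: "0 \<notin> set w \<Longrightarrow> 0 < cyl_length w"
  by (induction w) (auto simp: p_pos Suc_le_eq intro!: mult_pos_pos)

lemma cylinder_bounds:
  assumes "0 \<notin> set w"
  shows "0 \<le> left_end w" "left_end w + cyl_length w \<le> 1"
proof -
  have "0 \<le> left_end w \<and> left_end w + cyl_length w \<le> 1"
    using assms
  proof (induction w)
    case (Cons a w)
    then have a: "a \<ge> 1" by auto
    have IH: "0 \<le> left_end w" "left_end w + cyl_length w \<le> 1"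
      using Cons by auto
    have "p a * (left_end w + cyl_length w) \<le> p a * 1"
      using IH p_pos[OF a] by (intro mult_left_mono) auto
    then show ?case
      using I_bounds[OF a] IH p_pos[OF a] by (auto simp: algebra_simps)
  qed simp
  then show "0 \<le> left_end w" "left_end w + cyl_length w \<le> 1" by auto
qed

lemma cylinder_antimono: "0 \<notin> set (v @ w) \<Longrightarrow> cylinder (v @ w) \<subseteq> cylinder v"
proof -
  assume "0 \<notin> set (v @ w)"
  then have "0 < cyl_length v" "0 \<le> left_end w" "left_end w + cyl_length w \<le> 1"
    using cyl_length_pos[of v] cylinder_bounds[of w] by auto
  then have "0 \<le> cyl_length v * left_end w"
    "cyl_length v * (left_end w + cyl_length w) \<le> cyl_length v * 1"
    by (auto intro!: mult_left_mono)
  then show ?thesis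
    by (auto simp: cylinder_def left_end_append algebra_simps)
qed

text \<open>
The map sends \<open>cylinder (a # w)\<close> into \<open>cylinder w\<close>, so the digits of a point can be read off from any
cylinder that contains it.
\<close>

lemma digit_cylinder:
  assumes "0 \<notin> set w" and "x \<in> cylinder w" and "i < length w"
  shows "digit p I (Suc i) x = w ! i"
  using assms
proof (induction w arbitrary: x i)
  case (Cons a w)
  then have a: "a \<ge> 1" by auto
  have "x \<in> cylinder [a]"
    using cylinder_antimono[of "[a]" w] Cons.prems by auto
  then have xa: "x \<in> I a"
    by (simp add: cylinder_def I_eq[OF a])
  show ?case
  proof (cases i)
    case 0
    then show ?thesis by (simp add: digit_def branch_index_eq[OF a xa])
  next
    case (Suc j)
    have "full_branch_map p I x \<in> cylinder w"
      using Cons.prems p_pos[OF a]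
      by (auto simp: full_branch_map_eq[OF a xa] cylinder_def field_simps)
    then have "digit p I (Suc j) (full_branch_map p I x) = w ! j"
      using Cons Suc by auto
    then show ?thesis
      using Suc by (simp add: digit_def funpow_swap1)
  qed
qed simp

lemma cylinders_comparable:
  assumes "0 \<notin> set v" "0 \<notin> set w" "x \<in> cylinder v" "x \<in> cylinder w" "length v \<le> length w"
  shows "prefix v w"
proof -
  have "take (length v) w = v"
    using assms by (intro nth_equalityI) (auto simp flip: digit_cylinder)
  then show ?thesis by (metis take_is_prefix)
qed

lemma cyl_length_le_power:
  assumes "\<And>a. a \<ge> 1 \<Longrightarrow> p a \<le> \<theta>" "0 \<le> \<theta>" "0 \<notin> set w"
  shows "cyl_length w \<le> \<theta> ^ length w"
  using assms(3)
proof (induction w)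
  case (Cons a w)
  then have "a \<ge> 1" by auto
  then show ?case
    using Cons assms(1)[of a] assms(2) p_pos[of a] cyl_length_pos[of w] by (auto intro!: mult_mono)
qed simp

lemma cyl_length_tendsto_0:
  assumes "\<And>i. \<omega> i \<noteq> 0"
  shows "(\<lambda>n. cyl_length (map \<omega> [0..<n])) \<longlonglongrightarrow> 0"
proof -
  obtain \<theta> where \<theta>: "0 < \<theta>" "\<theta> < 1" "\<And>a. a \<ge> 1 \<Longrightarrow> p a \<le> \<theta>"
    by (rule p_le_contraction_rate) blast
  have no0: "0 \<notin> set (map \<omega> [0..<n])" for n
    using assms by (auto simp: image_iff dest: sym)
  show ?thesis
  proof (rule tendsto_sandwich)
    show "\<forall>\<^sub>F n in sequentially. cyl_length (map \<omega> [0..<n]) \<le> \<theta> ^ n"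
      using cyl_length_le_power[OF \<theta>(3) _ no0] \<theta> by (auto intro!: always_eventually)
    show "\<forall>\<^sub>F n in sequentially. 0 \<le> cyl_length (map \<omega> [0..<n])"
      using cyl_length_pos[OF no0] by (auto intro!: always_eventually less_imp_le)
    show "(\<lambda>_. 0 :: real) \<longlonglongrightarrow> 0" by simp
    show "(\<lambda>n. \<theta> ^ n) \<longlonglongrightarrow> 0"
      using \<theta> by (intro LIMSEQ_power_zero) auto
  qed
qed

text \<open>
The supremum of the left ends lies in the closure of every cylinder. It could fail to lie in the
half-open cylinders only if their right ends were eventually constant, that is, if from some index on every digit
were the one whose interval ends at 1. At most one digit has this property, and a sequence with
infinitely many distinct digits cannot end in its repetition.
\<close>

lemma point_with_digits:
  fixes \<omega> :: "nat \<Rightarrow> nat"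
  assumes nz: "\<And>i. \<omega> i \<noteq> 0" and inf: "infinite (range \<omega>)"
  obtains x where "\<And>n. x \<in> cylinder (map \<omega> [0..<n])"
proof -
  define w where "w n = map \<omega> [0..<n]" for n
  have no0: "0 \<notin> set (w n)" for n
    using nz by (auto simp: w_def image_iff dest: sym)
  define l where "l n = left_end (w n)" for n
  define r where "r n = left_end (w n) + cyl_length (w n)" for n
  have w_Suc: "w (Suc n) = w n @ [\<omega> n]" for n
    by (simp add: w_def)
  have offset: "0 \<le> offset (\<omega> n)" "offset (\<omega> n) + p (\<omega> n) \<le> 1" for n
    using I_bounds[of "\<omega> n"] nz[of n] by auto
  have len_pos: "0 < cyl_length (w n)" for n
    by (rule cyl_length_pos[OF no0])
  have l_Suc: "l (Suc n) = l n + cyl_length (w n) * offset (\<omega> n)" for n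
    by (simp add: l_def w_Suc left_end_append)
  have r_Suc: "r (Suc n) = r n - cyl_length (w n) * (1 - (offset (\<omega> n) + p (\<omega> n)))" for n
    by (simp add: r_def w_Suc left_end_append algebra_simps)
  have "incseq l"
    using offset len_pos by (intro incseq_SucI) (simp add: l_Suc less_imp_le)
  have "decseq r"
    using offset len_pos by (intro decseq_SucI) (simp add: r_Suc less_imp_le)
  have l_less_r: "l n < r n" for n
    using len_pos by (simp add: l_def r_def)
  have l_le_r: "l m \<le> r n" for m n
  proof (cases "m \<le> n")
    case True
    then show ?thesis using incseqD[OF \<open>incseq l\<close> True] l_less_r[of n] by linarith
  next
    case False
    then show ?thesis using decseqD[OF \<open>decseq r\<close>, of n m] l_less_r[of m] by linarith
  qed
  \<comment> \<open>Two intervals that both end at 1 would overlap, so the digits would be constant from \<open>n\<close> on.\<close>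
  have shrink: "\<exists>m>n. r m < r n" for n
  proof -
    have "\<exists>i\<ge>n. offset (\<omega> i) + p (\<omega> i) < 1"
    proof (rule ccontr)
      assume "\<not> (\<exists>i\<ge>n. offset (\<omega> i) + p (\<omega> i) < 1)"
      then have right: "offset (\<omega> i) + p (\<omega> i) = 1" if "n \<le> i" for i
        using offset(2)[of i] that by (auto simp: not_less intro: antisym)
      have "\<omega> i = \<omega> n" if "n \<le> i" for i
      proof (rule I_disjoint)
        define y where "y = max (offset (\<omega> i)) (offset (\<omega> n))"
        have pos: "0 < p (\<omega> i)" "0 < p (\<omega> n)"
          using p_pos nz by (simp_all add: Suc_le_eq)
        show "1 \<le> \<omega> i" "1 \<le> \<omega> n"
          using nz by (simp_all add: Suc_le_eq)
        then show "y \<in> I (\<omega> i)" "y \<in> I (\<omega> n)"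
          using pos right[OF that] right[OF order_refl] by (auto simp: I_eq y_def)
      qed
      then have "range \<omega> \<subseteq> \<omega> ` {..n}"
        by (metis (no_types, lifting) atMost_iff image_eqI image_subsetI nle_le)
      then show False using inf finite_surj by blast
    qed
    then obtain i where i: "n \<le> i" "offset (\<omega> i) + p (\<omega> i) < 1" by blast
    have "r (Suc i) < r i"
      using i len_pos[of i] by (simp add: r_Suc)
    moreover have "r i \<le> r n" using \<open>decseq r\<close> i by (auto dest: decseqD)
    ultimately show ?thesis using i by (auto intro!: exI[of _ "Suc i"])
  qed
  define x where "x = (SUP n. l n)"
  have bdd: "bdd_above (range l)"
    using l_le_r[of _ 0] by (intro bdd_aboveI) auto
  have "l n \<le> x" for n
    unfolding x_def using bdd by (intro cSUP_upper) auto
  moreover have "x < r n" for n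
  proof -
    obtain m where "r m < r n" using shrink by blast
    moreover have "x \<le> r m"
      unfolding x_def using l_le_r by (intro cSUP_least) auto
    ultimately show ?thesis by simp
  qed
  ultimately show thesis
    by (intro that[of x]) (auto simp: cylinder_def l_def r_def simp flip: w_def)
qed

section \<open>A mass distribution principle on words\<close>

text \<open>
The words meeting \<open>U\<close> that are cut at the first moment when the cylinder has length at most \<open>r\<close>. They
discretise \<open>U\<close> at scale \<open>r\<close>.
\<close>

definition stopped_words :: "real \<Rightarrow> real set \<Rightarrow> nat list set" where
  "stopped_words r U =
     {w. 0 \<notin> set w \<and> w \<noteq> [] \<and> cyl_length w \<le> r \<and> r < cyl_length (butlast w) \<and> cylinder w \<inter> U \<noteq> {}}"

lemma cyl_length_antimono:
  assumes "prefix v w" "0 \<notin> set w"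
  shows "cyl_length w \<le> cyl_length v"
proof -
  obtain u where w: "w = v @ u" using assms by (auto simp: prefix_def)
  have "cyl_length u \<le> 1"
    using cylinder_bounds[of u] assms by (auto simp: w)
  then show ?thesis
    using cyl_length_pos[of v] assms by (simp add: w mult_left_le)
qed

text \<open>
Cylinders that meet belong to comparable words, and of two comparable words only one can be the place
where the length first drops to \<open>r\<close>.
\<close>

lemma disjoint_stopped_cylinders: "disjoint_family_on cylinder (stopped_words r U)"
proof -
  have eq: "v = w"
    if v: "v \<in> stopped_words r U" and w: "w \<in> stopped_words r U"
      and x: "x \<in> cylinder v" "x \<in> cylinder w" and len: "length v \<le> length w" for v w x
  proof (rule ccontr)
    assume "v \<noteq> w"
    have "prefix v w"
      using v w x len by (auto simp: stopped_words_def intro: cylinders_comparable)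
    moreover have "w = butlast w @ [last w]"
      using w by (simp add: stopped_words_def)
    ultimately have "prefix v (butlast w)"
      using \<open>v \<noteq> w\<close> prefix_snoc[of v "butlast w" "last w"] by simp
    then have "cyl_length (butlast w) \<le> cyl_length v"
      using w by (intro cyl_length_antimono) (auto simp: stopped_words_def dest: in_set_butlastD)
    then show False using v w by (simp add: stopped_words_def)
  qed
  show ?thesis
    unfolding disjoint_family_on_def using eq by (metis disjoint_iff nle_le)
qed

text \<open>
The hypothesis on \<open>q\<close> compares the mass of a word with the length of its cylinder and that of
its parent. The parent of a stopped word is longer than \<open>r\<close>, which turns the bound into
\<open>K * r powr (s - 1)\<close> times the length. The
stopped cylinders are disjoint and lie within distance \<open>2 * r\<close> of a point of \<open>U\<close>, so their lengths add
up to at most \<open>4 * r\<close>.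
\<close>

lemma emeasure_stopped_words_le:
  assumes nonneg: "\<And>i a. 0 \<le> q i a"
    and compare: "\<And>v a. 0 \<notin> set (v @ [a]) \<Longrightarrow>
      word_mass q (v @ [a]) \<le> K * cyl_length (v @ [a]) * cyl_length v powr (s - 1)"
    and s: "s < 1" and K: "0 \<le> K"
    and U: "bounded U" "diameter U \<le> r" and r: "0 < r"
  shows "emeasure (word_measure q) (stopped_words r U) \<le> ennreal (4 * K * r powr s)"
proof (cases "U = {}")
  case True
  then show ?thesis by (simp add: stopped_words_def)
next
  case False
  then obtain u where u: "u \<in> U" by blast
  let ?W = "stopped_words r U"
  let ?k = "K * r powr (s - 1)"
  have mass: "word_mass q w \<le> ?k * cyl_length w" if w: "w \<in> ?W" for w
  proof -
    define v where "v = butlast w"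
    have w_eq: "w = v @ [last w]" and no0: "0 \<notin> set w" and len: "r < cyl_length v"
      using w by (simp_all add: stopped_words_def v_def)
    have "cyl_length v powr (s - 1) \<le> r powr (s - 1)"
      using s r len by (intro powr_mono2') auto
    then have "K * cyl_length w * cyl_length v powr (s - 1) \<le> K * cyl_length w * r powr (s - 1)"
      using K cyl_length_pos[OF no0] by (intro mult_left_mono) auto
    then show ?thesis
      using compare[of v "last w"] no0 w_eq by (simp add: mult.assoc mult.left_commute mult.commute)
  qed
  have near: "cylinder w \<subseteq> {u - 2 * r..u + 2 * r}" if w: "w \<in> ?W" for w
  proof -
    obtain y where y: "y \<in> cylinder w" "y \<in> U" using w by (auto simp: stopped_words_def)
    have "dist u y \<le> r"
      using diameter_bounded_bound[OF U(1) u y(2)] U(2) by simp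
    moreover have "cyl_length w \<le> r" using w by (simp add: stopped_words_def)
    ultimately show ?thesis
      using y(1) by (auto simp: cylinder_def dist_real_def)
  qed
  have "(\<integral>\<^sup>+ w. emeasure lborel (cylinder w) \<partial>count_space ?W)
      = emeasure lborel (\<Union>w\<in>?W. cylinder w)"
    by (rule emeasure_UN_countable[symmetric, OF _ _ disjoint_stopped_cylinders])
      (auto simp: cylinder_def)
  also have "\<dots> \<le> emeasure lborel {u - 2 * r..u + 2 * r}"
    using near by (intro emeasure_mono) auto
  also have "\<dots> = ennreal (4 * r)"
    using r by simp
  finally have total_length:
    "(\<integral>\<^sup>+ w. emeasure lborel (cylinder w) \<partial>count_space ?W) \<le> ennreal (4 * r)" .
  have "emeasure (word_measure q) ?W
      = (\<integral>\<^sup>+ w. ennreal (word_mass q w) * indicator ?W w \<partial>count_space UNIV)"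
    by (rule emeasure_word_measure)
  also have "\<dots> \<le> (\<integral>\<^sup>+ w. ennreal ?k * (emeasure lborel (cylinder w) * indicator ?W w) \<partial>count_space UNIV)"
  proof (rule nn_integral_mono)
    fix w
    show "ennreal (word_mass q w) * indicator ?W w
      \<le> ennreal ?k * (emeasure lborel (cylinder w) * indicator ?W w)"
    proof (cases "w \<in> ?W")
      case True
      then have "0 < cyl_length w" by (auto simp: stopped_words_def intro: cyl_length_pos)
      then show ?thesis
        using mass[OF True] True K
        by (simp add: cylinder_def ennreal_mult[symmetric] ennreal_leI)
    qed simp
  qed
  also have "\<dots> = ennreal ?k * (\<integral>\<^sup>+ w. emeasure lborel (cylinder w) \<partial>count_space ?W)"
    by (simp add: nn_integral_cmult nn_integral_count_space_indicator)
  also have "\<dots> \<le> ennreal ?k * ennreal (4 * r)"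
    using total_length by (rule mult_left_mono) simp
  also have "\<dots> = ennreal (4 * K * r powr s)"
    using K r by (simp add: ennreal_mult[symmetric] powr_diff)
  finally show ?thesis .
qed

lemma stopped_prefix:
  assumes nz: "\<And>i. \<omega> i \<noteq> 0" and x: "\<And>n. x \<in> cylinder (map \<omega> [0..<n])"
    and U: "x \<in> U" and r: "0 < r" "r < 1"
  obtains n where "map \<omega> [0..<n] \<in> stopped_words r U"
proof -
  have "eventually (\<lambda>n. cyl_length (map \<omega> [0..<n]) < r) sequentially"
    using order_tendstoD(2)[OF cyl_length_tendsto_0[of \<omega>] r(1)] nz by simp
  then have "\<exists>n. cyl_length (map \<omega> [0..<n]) \<le> r"
    by (auto simp: eventually_sequentially intro: less_imp_le)
  then obtain n where n: "cyl_length (map \<omega> [0..<n]) \<le> r"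
    and least: "\<And>m. m < n \<Longrightarrow> r < cyl_length (map \<omega> [0..<m])"
    unfolding exists_least_iff[of "\<lambda>n. cyl_length (map \<omega> [0..<n]) \<le> r"] not_le by blast
  obtain m where m: "n = Suc m"
    using n r by (cases n) auto
  have "0 \<notin> set (map \<omega> [0..<n])"
    using nz by (auto simp: image_iff dest: sym)
  then have "map \<omega> [0..<n] \<in> stopped_words r U"
    using n least[of m] x[of n] U by (auto simp: stopped_words_def m)
  then show thesis by (rule that)
qed

text \<open>
Passing from \<open>t\<close> to a larger positive exponent makes the gauge smaller; this disposes of \<open>t = 0\<close>, where the
gauge of a nonempty set is 1.
\<close>

lemma powr_diameter_le_gauge:
  assumes "0 \<le> t" "t \<le> s" "0 < s" "bounded U" "diameter U \<le> 1"
  shows "ennreal (diameter U powr s) \<le> hausdorff_gauge t U"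
proof -
  have "0 \<le> diameter U" using assms(4) by (rule diameter_ge_0)
  then have "diameter U powr s \<le> 1" "diameter U powr s \<le> diameter U powr t"
    using assms by (auto intro: powr_le1 powr_mono')
  then show ?thesis
    using assms by (auto simp: hausdorff_gauge_def intro: ennreal_leI)
qed

text \<open>
If the measure vanished, there would be a cover with arbitrarily small total gauge, whose stopped
words have total mass below 1. A sequence avoiding all of them has a point in \<open>E\<close>, this point
lies in some covering set, and then a prefix of the sequence is a stopped word after all.
\<close>

lemma hausdorff_measure_ne_0:
  assumes nonneg: "\<And>i a. 0 \<le> q i a"
    and total: "\<And>i. q i sums 1"
    and zero: "\<And>i. q i 0 = 0"
    and compare: "\<And>v a. 0 \<notin> set (v @ [a]) \<Longrightarrow>
      word_mass q (v @ [a]) \<le> K * cyl_length (v @ [a]) * cyl_length v powr (s - 1)"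
    and s: "0 < s" "s < 1" and t: "0 \<le> t" "t \<le> s"
    and points: "\<And>\<omega>. (\<And>n. 0 < q n (\<omega> n)) \<Longrightarrow> \<exists>x\<in>E. \<forall>n. x \<in> cylinder (map \<omega> [0..<n])"
  shows "hausdorff_measure t E \<noteq> 0"
proof
  assume "hausdorff_measure t E = 0"
  then have "hausdorff_premeasure t 1 E \<le> 0"
    unfolding hausdorff_measure_def by (metis SUP_upper greaterThan_iff zero_less_one)
  define C where "C = max K 1"
  have C: "1 \<le> C" "K \<le> C" by (simp_all add: C_def)
  \<comment> \<open>The stopped words will have total mass at most \<open>4 * C * (2 * \<epsilon>) = 1 / 2\<close>.\<close>
  define \<epsilon> where "\<epsilon> = 1 / (16 * C)"
  have \<epsilon>: "0 < \<epsilon>" "2 * \<epsilon> < 1" "4 * C * (2 * \<epsilon>) < 1"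
    using C by (auto simp: \<epsilon>_def field_simps)
  have compare': "word_mass q (v @ [a]) \<le> C * cyl_length (v @ [a]) * cyl_length v powr (s - 1)"
    if "0 \<notin> set (v @ [a])" for v a
  proof -
    have "K * (cyl_length (v @ [a]) * cyl_length v powr (s - 1))
        \<le> C * (cyl_length (v @ [a]) * cyl_length v powr (s - 1))"
      using C cyl_length_pos[OF that] by (intro mult_right_mono) auto
    then show ?thesis using compare[OF that] by (simp only: mult.assoc)
  qed
  have "(INF U \<in> delta_covers 1 E. \<Sum>i. hausdorff_gauge t (U i)) < ennreal \<epsilon>"
    using \<open>hausdorff_premeasure t 1 E \<le> 0\<close> \<epsilon> unfolding hausdorff_premeasure_def
    by (auto simp: ennreal_less_zero_iff)
  then obtain U where cover: "U \<in> delta_covers 1 E"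
    and small: "(\<Sum>i. hausdorff_gauge t (U i)) < ennreal \<epsilon>"
    by (auto simp: INF_less_iff)
  have U: "bounded (U i)" "diameter (U i) \<le> 1" for i
    using cover by (auto simp: delta_covers_def)
  \<comment> \<open>A covering set may have diameter 0; enlarging the scales by a summable amount makes them positive.\<close>
  define g where "g i = diameter (U i) powr s + \<epsilon> * (1 / 2) ^ Suc i" for i
  define r where "r i = g i powr (1 / s)" for i
  have g_pos: "0 < g i" for i
    using \<epsilon> by (auto simp: g_def intro: add_nonneg_pos)
  have r_pos: "0 < r i" and r_powr: "r i powr s = g i" for i
    using g_pos[of i] s by (auto simp: r_def powr_powr)
  have diam_r: "diameter (U i) \<le> r i" for i
  proof -
    have "diameter (U i) = (diameter (U i) powr s) powr (1 / s)"
      using s diameter_ge_0[OF U(1)] by (simp add: powr_powr)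
    also have "\<dots> \<le> r i"
      unfolding r_def g_def using s \<epsilon> by (intro powr_mono2) auto
    finally show ?thesis .
  qed
  have sum_g: "(\<Sum>i. ennreal (g i)) \<le> ennreal (2 * \<epsilon>)"
  proof -
    have "(\<Sum>i. ennreal (g i))
        = (\<Sum>i. ennreal (diameter (U i) powr s) + ennreal (\<epsilon> * (1 / 2) ^ Suc i))"
      using \<epsilon> by (simp add: g_def)
    also have "\<dots> = (\<Sum>i. ennreal (diameter (U i) powr s)) + (\<Sum>i. ennreal (\<epsilon> * (1 / 2) ^ Suc i))"
      by (intro suminf_add[symmetric]) auto
    also have "(\<Sum>i. ennreal (\<epsilon> * (1 / 2) ^ Suc i)) = ennreal (\<epsilon> * 1)"
      using \<epsilon> by (intro suminf_ennreal_eq sums_mult power_half_series) auto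
    also have "(\<Sum>i. ennreal (diameter (U i) powr s)) \<le> (\<Sum>i. hausdorff_gauge t (U i))"
      using U s t by (intro suminf_le powr_diameter_le_gauge) auto
    also have "\<dots> \<le> ennreal \<epsilon>"
      using small by simp
    finally show ?thesis
      using \<epsilon> by (simp add: ennreal_plus[symmetric] del: ennreal_plus)
  qed
  have r_less_1: "r i < 1" for i
  proof -
    have "ennreal (g i) \<le> (\<Sum>i. ennreal (g i))"
      using sum_le_suminf[of "\<lambda>i. ennreal (g i)" "{i}"] by simp
    also note sum_g
    finally have "g i < 1" using \<epsilon> by (simp add: ennreal_le_iff)
    then have "g i powr (1 / s) < 1 powr (1 / s)"
      using g_pos[of i] s by (intro powr_less_mono2) auto
    then show ?thesis by (simp add: r_def)
  qed
  define W where "W = (\<Union>i. stopped_words (r i) (U i))"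
  have "emeasure (word_measure q) W \<le> (\<Sum>i. emeasure (word_measure q) (stopped_words (r i) (U i)))"
    unfolding W_def by (intro emeasure_subadditive_countably) auto
  also have "\<dots> \<le> (\<Sum>i. ennreal (4 * C) * ennreal (g i))"
  proof (intro suminf_le allI)
    fix i
    have "emeasure (word_measure q) (stopped_words (r i) (U i)) \<le> ennreal (4 * C * r i powr s)"
      using C s U diam_r r_pos compare' nonneg by (intro emeasure_stopped_words_le) auto
    then show "emeasure (word_measure q) (stopped_words (r i) (U i)) \<le> ennreal (4 * C) * ennreal (g i)"
      using C g_pos[of i] by (simp add: r_powr ennreal_mult)
  qed auto
  also have "\<dots> = ennreal (4 * C) * (\<Sum>i. ennreal (g i))"
    by (rule ennreal_suminf_cmult)
  also have "\<dots> \<le> ennreal (4 * C) * ennreal (2 * \<epsilon>)"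
    using sum_g by (rule mult_left_mono) simp
  also have "\<dots> < 1"
    using \<epsilon> C by (simp add: ennreal_mult[symmetric] ennreal_less_one_iff)
  finally have "emeasure (word_measure q) W < 1" .
  then obtain \<omega> where avoid: "\<And>n. map \<omega> [0..<n] \<notin> W" and pos: "\<And>n. 0 < q n (\<omega> n)"
    by (rule branch_avoiding_light_set[of q W, OF nonneg total]) blast
  obtain x where x: "x \<in> E" "\<And>n. x \<in> cylinder (map \<omega> [0..<n])"
    using points[of \<omega>, OF pos] by auto
  then obtain i where i: "x \<in> U i"
    using cover by (auto simp: delta_covers_def)
  have nz: "\<omega> n \<noteq> 0" for n
    using pos[of n] zero[of n] by (intro notI) simp
  obtain n where "map \<omega> [0..<n] \<in> stopped_words (r i) (U i)"
    by (rule stopped_prefix[of \<omega>, OF nz x(2) i r_pos r_less_1])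
  then show False using avoid[of n] unfolding W_def by blast
qed

end

section \<open>Estimates for regularly varying sequences and counting functions\<close>

text \<open>
For large \<open>k\<close>, halving the index at most doubles \<open>L\<close>. Iterating this
\<open>log 2 k\<close> times costs at most a factor of order \<open>k\<close>.
\<close>

lemma slowly_varying_lower_bound:
  assumes "slowly_varying L"
  obtains C where "0 < C" and "\<And>k. k \<ge> 1 \<Longrightarrow> C / real k \<le> L k"
proof -
  have pos: "0 < L k" if "k \<ge> 1" for k
    using assms that by (simp add: slowly_varying_def)
  have "(\<lambda>k. L (nat \<lfloor>(1 / 2) * real k\<rfloor>) / L k) \<longlonglongrightarrow> 1"
    using assms unfolding slowly_varying_def by (metis half_gt_zero zero_less_one)
  moreover have "nat \<lfloor>(1 / 2) * real k\<rfloor> = k div 2" for k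
    by (simp add: floor_divide_of_nat_eq[of k 2, simplified] nat_div_distrib)
  ultimately have "(\<lambda>k. L (k div 2) / L k) \<longlonglongrightarrow> 1"
    by simp
  then have "\<forall>\<^sub>F k in sequentially. L (k div 2) / L k < 2"
    by (rule order_tendstoD) simp
  then obtain m where m: "\<And>k. k \<ge> m \<Longrightarrow> L (k div 2) / L k < 2"
    by (auto simp: eventually_sequentially)
  \<comment> \<open>The lower bound 2 ensures that halving an index above \<open>k0\<close> leaves it positive.\<close>
  define k0 where "k0 = max m 2"
  define C where "C = Min (L ` {1..k0})"
  have C: "C \<le> L k" if "1 \<le> k" "k \<le> k0" for k
    using that by (auto simp: C_def)
  have "C \<in> L ` {1..k0}"
    unfolding C_def by (rule Min_in) (auto simp: k0_def)
  then have "0 < C"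
    using pos by auto
  moreover have "C / real k \<le> L k" if "k \<ge> 1" for k
    using that
  proof (induction k rule: less_induct)
    case (less k)
    show ?case
    proof (cases "k \<le> k0")
      case True
      have "C / real k \<le> C"
        using \<open>0 < C\<close> less.prems by (simp add: divide_le_eq mult_le_cancel_left1)
      then show ?thesis using C[OF less.prems True] by simp
    next
      case False
      then have k: "k \<ge> m" "k div 2 \<ge> 1" "k div 2 < k"
        by (auto simp: k0_def)
      have half: "real (k div 2) \<le> real k / 2"
        by linarith
      have "2 * (C / real k) = C / (real k / 2)"
        by simp
      also have "\<dots> \<le> C / real (k div 2)"
        using k half \<open>0 < C\<close> by (intro divide_left_mono) auto
      also have "\<dots> \<le> L (k div 2)"
        using less.IH k by blast
      also have "\<dots> \<le> 2 * L k"
        using m[OF k(1)] pos[OF less.prems] by (simp add: field_simps)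
      finally show ?thesis by simp
    qed
  qed
  ultimately show thesis by (rule that)
qed

lemma regularly_varying_lower_bound:
  assumes p: "\<And>k. k \<ge> 1 \<Longrightarrow> 0 < p k" and "\<rho> \<ge> 1" and rv: "regularly_varying p \<rho>"
  obtains C M where "0 < C" and "0 \<le> M" and "\<And>k. k \<ge> 1 \<Longrightarrow> C * real k powr (- M) \<le> p k"
proof -
  obtain L where L: "slowly_varying L" "(\<lambda>k. p k / (real k powr (- \<rho>) * L k)) \<longlonglongrightarrow> 1"
    using rv by (auto simp: regularly_varying_def)
  have L_pos: "0 < L k" if "k \<ge> 1" for k
    using L(1) that by (simp add: slowly_varying_def)
  obtain C where C: "0 < C" "\<And>k. k \<ge> 1 \<Longrightarrow> C / real k \<le> L k"
    using L(1) by (rule slowly_varying_lower_bound) blast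
  have "\<forall>\<^sub>F k in sequentially. 1 / 2 < p k / (real k powr (- \<rho>) * L k)"
    using L(2) by (rule order_tendstoD) simp
  then obtain m where m: "\<And>k. k \<ge> m \<Longrightarrow> 1 / 2 < p k / (real k powr (- \<rho>) * L k)"
    by (auto simp: eventually_sequentially)
  define C' where "C' = Min (insert (C / 2) (p ` {1..m}))"
  have "C' \<in> insert (C / 2) (p ` {1..m})"
    unfolding C'_def by (rule Min_in) auto
  then have "0 < C'"
    using p C by auto
  moreover have "0 \<le> \<rho> + 1" using \<open>\<rho> \<ge> 1\<close> by simp
  moreover have "C' * real k powr (- (\<rho> + 1)) \<le> p k" if k: "k \<ge> 1" for k
  proof (cases "k \<le> m")
    case True
    have "real k powr (- (\<rho> + 1)) \<le> 1"
      using k \<open>\<rho> \<ge> 1\<close> powr_mono[of "- (\<rho> + 1)" 0 "real k"] by simp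
    then have "C' * real k powr (- (\<rho> + 1)) \<le> C'"
      using \<open>0 < C'\<close> by simp
    also have "C' \<le> p k" unfolding C'_def using True k by (intro Min_le) auto
    finally show ?thesis .
  next
    case False
    have "C' \<le> C / 2" unfolding C'_def by (intro Min_le) auto
    then have "C' * real k powr (- (\<rho> + 1)) \<le> C / 2 * real k powr (- (\<rho> + 1))"
      by (rule mult_right_mono) simp
    also have "C / 2 * real k powr (- (\<rho> + 1)) = 1 / 2 * (real k powr (- \<rho>) * (C / real k))"
      using k powr_diff[of "real k" "- \<rho>" 1] by simp
    also have "\<dots> \<le> 1 / 2 * (real k powr (- \<rho>) * L k)"
      using C(2)[OF k] by (intro mult_left_mono) auto
    also have "\<dots> \<le> p k"
      using m[of k] False L_pos[OF k] k by (simp add: field_simps)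
    finally show ?thesis .
  qed
  ultimately show thesis by (rule that)
qed

text \<open>
Rounding \<open>c * n powr \<beta>\<close> down may give jumps larger than 1 for small \<open>n\<close>, but the increments become
less than 1 because \<open>\<beta> < 1\<close>. Starting late, at \<open>n0\<close>, and subtracting the initial value does not affect the limit.
\<close>

lemma unit_step_counting_function:
  fixes \<beta> c :: real
  assumes "0 < \<beta>" "\<beta> < 1" "0 < c"
  obtains J :: "nat \<Rightarrow> nat"
  where "J 0 = 0" and "\<And>n. J (Suc n) = J n \<or> J (Suc n) = Suc (J n)"
    and "(\<lambda>n. real (J n) / real n powr \<beta>) \<longlonglongrightarrow> c"
proof -
  define g where "g n = c * real n powr \<beta>" for n :: nat
  have "(\<lambda>n. c * (real n + 1) powr \<beta> - c * real n powr \<beta>) \<longlonglongrightarrow> 0"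
    using assms by real_asymp
  then have "\<forall>\<^sub>F n in sequentially. c * (real n + 1) powr \<beta> - c * real n powr \<beta> < 1"
    by (rule order_tendstoD) simp
  then obtain n0 where n0: "\<And>n. n \<ge> n0 \<Longrightarrow> g (Suc n) - g n < 1"
    by (auto simp: eventually_sequentially g_def add.commute)
  have g_mono: "g m \<le> g n" if "m \<le> n" for m n
    unfolding g_def using assms that by (intro mult_left_mono powr_mono2) auto
  define J where "J n = nat (\<lfloor>g (n + n0)\<rfloor> - \<lfloor>g n0\<rfloor>)" for n
  have J: "int (J n) = \<lfloor>g (n + n0)\<rfloor> - \<lfloor>g n0\<rfloor>" for n
    using g_mono[of n0 "n + n0"] by (auto simp: J_def floor_mono)
  show thesis
  proof
    show "J 0 = 0" by (simp add: J_def)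
    show "J (Suc n) = J n \<or> J (Suc n) = Suc (J n)" for n
    proof -
      have "g (n + n0) \<le> g (Suc n + n0)" "g (Suc n + n0) < g (n + n0) + 1"
        using g_mono[of "n + n0" "Suc n + n0"] n0[of "n + n0"] by auto
      then have "\<lfloor>g (n + n0)\<rfloor> \<le> \<lfloor>g (Suc n + n0)\<rfloor>" "\<lfloor>g (Suc n + n0)\<rfloor> \<le> \<lfloor>g (n + n0)\<rfloor> + 1"
        by linarith+
      then show ?thesis using J[of n] J[of "Suc n"] by linarith
    qed
    have J_bounds: "c * (real n + real n0) powr \<beta> - g n0 - 1 \<le> real (J n)"
      "real (J n) \<le> c * (real n + real n0) powr \<beta> - g n0 + 1" for n
    proof -
      have "real (J n) = of_int \<lfloor>g (n + n0)\<rfloor> - of_int \<lfloor>g n0\<rfloor>"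
        using J[of n] by (metis of_int_diff of_int_of_nat_eq)
      then show "c * (real n + real n0) powr \<beta> - g n0 - 1 \<le> real (J n)"
        "real (J n) \<le> c * (real n + real n0) powr \<beta> - g n0 + 1"
        using g_def[of "n + n0"] by (simp_all, linarith+)
    qed
    show "(\<lambda>n. real (J n) / real n powr \<beta>) \<longlonglongrightarrow> c"
    proof (rule tendsto_sandwich)
      show "\<forall>\<^sub>F n in sequentially. (c * (real n + real n0) powr \<beta> - g n0 - 1) / real n powr \<beta>
          \<le> real (J n) / real n powr \<beta>"
        using J_bounds(1) by (intro always_eventually allI divide_right_mono) auto
      show "\<forall>\<^sub>F n in sequentially. real (J n) / real n powr \<beta>
          \<le> (c * (real n + real n0) powr \<beta> - g n0 + 1) / real n powr \<beta>"
        using J_bounds(2) by (intro always_eventually allI divide_right_mono) auto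
      show "(\<lambda>n. (c * (real n + real n0) powr \<beta> - g n0 - 1) / real n powr \<beta>) \<longlonglongrightarrow> c"
        using assms by real_asymp
      show "(\<lambda>n. (c * (real n + real n0) powr \<beta> - g n0 + 1) / real n powr \<beta>) \<longlonglongrightarrow> c"
        using assms by real_asymp
    qed
  qed
qed

text \<open>
With \<open>J n\<close> of order \<open>n powr \<beta>\<close> the first term is of order \<open>n powr \<beta> * ln n\<close> and loses against
\<open>n * z\<close>.
\<close>

lemma sublinear_log_cost_bounded:
  fixes J :: "nat \<Rightarrow> nat" and A M z \<beta> c :: real
  assumes J: "(\<lambda>n. real (J n) / real n powr \<beta>) \<longlonglongrightarrow> c" and "\<beta> < 1" "0 < z"
  obtains K where "\<And>n. real (J n) * (A + M * ln (real N + real n)) - real n * z \<le> K"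
proof -
  let ?f = "\<lambda>n. real (J n) * (A + M * ln (real N + real n)) - real n * z"
  have "(\<lambda>n. real n powr (\<beta> - 1) * (A + M * ln (real N + real n))) \<longlonglongrightarrow> 0"
    using \<open>\<beta> < 1\<close> by real_asymp
  from tendsto_mult[OF J this]
  have "(\<lambda>n. real (J n) / real n powr \<beta> * (real n powr (\<beta> - 1) * (A + M * ln (real N + real n)))) \<longlonglongrightarrow> 0"
    by simp
  then have "\<forall>\<^sub>F n in sequentially.
      real (J n) / real n powr \<beta> * (real n powr (\<beta> - 1) * (A + M * ln (real N + real n))) < z"
    using \<open>0 < z\<close> by (rule order_tendstoD)
  then have "\<forall>\<^sub>F n in sequentially. ?f n \<le> 0"
    using eventually_gt_at_top[of 0]
  proof eventually_elim
    case (elim n)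
    then have "real (J n) * (A + M * ln (real N + real n)) / real n < z"
      by (simp add: powr_diff)
    then show ?case using elim by (simp add: field_simps)
  qed
  then obtain m where m: "\<And>n. n \<ge> m \<Longrightarrow> ?f n \<le> 0"
    by (auto simp: eventually_sequentially)
  have "?f n \<le> Max (insert 0 (?f ` {..<m}))" for n
  proof (cases "n < m")
    case True
    then show ?thesis by (intro Max_ge) auto
  next
    case False
    then have "?f n \<le> 0" using m[of n] by simp
    also have "0 \<le> Max (insert 0 (?f ` {..<m}))" by (intro Max_ge) auto
    finally show ?thesis .
  qed
  then show thesis by (rule that)
qed

section \<open>Sequences with planted new digits\<close>

context full_branch_system
begin

lemma p_le_1: "a \<ge> 1 \<Longrightarrow> p a \<le> 1"
  using sum_p_le_1[of "{a}"] by simp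

text \<open>
No power \<open>p a powr s\<close> is smaller than \<open>p a\<close>, and the power for \<open>a = 1\<close> is larger by some \<open>\<eta> > 0\<close>.
If all truncated sums of powers were at most 1, those of \<open>p\<close> would stay below \<open>1 - \<eta>\<close>.
\<close>

lemma truncated_pressure_gt_1:
  assumes s: "0 < s" "s < 1"
  obtains N where "1 \<le> N" and "1 < (\<Sum>a = 1..N. p a powr s)"
proof -
  define \<eta> where "\<eta> = p 1 powr s - p 1"
  have p: "0 < p a" "p a \<le> p a powr s" if "a \<ge> 1" for a
  proof -
    show "0 < p a" using that by (rule p_pos)
    then show "p a \<le> p a powr s"
      using powr_mono'[of s 1 "p a"] p_le_1[OF that] s by simp
  qed
  have "p 1 < 1"
    using sum_p_le_1[of "{1, 2}"] p_pos[of 2] by simp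
  then have \<eta>: "0 < \<eta>"
    using powr_less_mono'[of "p 1" s 1] p[of 1] s by (simp add: \<eta>_def)
  have "\<exists>N\<ge>1. 1 < (\<Sum>a = 1..N. p a powr s)"
  proof (rule ccontr)
    assume "\<not> (\<exists>N\<ge>1. 1 < (\<Sum>a = 1..N. p a powr s))"
    then have le: "(\<Sum>a = 1..N. p a powr s) \<le> 1" if "N \<ge> 1" for N
      using that by (auto simp: not_less)
    have "1 \<le> 1 - \<eta>"
    proof (rule has_sum_le_finite_sums)
      show "(p has_sum 1) {1..}"
        using probability by (simp add: probability_sequence_def)
      fix F assume F: "finite F" "F \<subseteq> {1::nat..}"
      define N where "N = Max (insert 1 F)"
      have N: "N \<ge> 1" "F \<subseteq> {1..N}"
        using F by (auto simp: N_def)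
      have "sum p F \<le> sum p {1..N}"
        using N p by (intro sum_mono2) (auto intro: less_imp_le)
      also have "\<dots> = p 1 + sum p {2..N}"
        using N(1) by (simp add: sum.atLeast_Suc_atMost numeral_2_eq_2)
      also have "\<dots> \<le> p 1 + (\<Sum>a = 2..N. p a powr s)"
        using p by (intro add_left_mono sum_mono) auto
      also have "\<dots> = (\<Sum>a = 1..N. p a powr s) - \<eta>"
        using N(1) by (simp add: sum.atLeast_Suc_atMost numeral_2_eq_2 \<eta>_def)
      also have "\<dots> \<le> 1 - \<eta>"
        using le[OF N(1)] by simp
      finally show "sum p F \<le> 1 - \<eta>" .
    qed
    then show False using \<eta> by simp
  qed
  then show thesis using that by blast
qed

end

text \<open>
Here \<open>J n\<close> counts the planted positions among the first \<open>n\<close>: position \<open>i\<close> is free if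
\<open>J (Suc i) = J i\<close> and otherwise carries the next new digit with certainty.
\<close>

definition planted_weight :: "(nat \<Rightarrow> real) \<Rightarrow> nat \<Rightarrow> (nat \<Rightarrow> nat) \<Rightarrow> nat \<Rightarrow> nat \<Rightarrow> real" where
  "planted_weight f N J i a =
     (if J (Suc i) = J i then (if a \<in> {1..N} then f a / sum f {1..N} else 0)
      else (if a = N + J (Suc i) then 1 else 0))"

lemma planted_digits:
  assumes J: "J 0 = 0" "\<And>n. J (Suc n) = J n \<or> J (Suc n) = Suc (J n)"
    and pos: "\<And>i. 0 < planted_weight f N J i (\<omega> i)"
  shows "{N<..N + J n} \<subseteq> \<omega> ` {..<n}" "\<omega> ` {..<n} \<subseteq> {1..N + J n}"
proof -
  have digit: "(J (Suc i) = J i \<and> \<omega> i \<in> {1..N}) \<or> (J (Suc i) = Suc (J i) \<and> \<omega> i = N + J (Suc i))" for i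
    using pos[of i] J(2)[of i] by (auto simp: planted_weight_def split: if_splits)
  show "{N<..N + J n} \<subseteq> \<omega> ` {..<n}"
  proof (induction n)
    case (Suc n)
    show ?case
      using Suc digit[of n] by (auto simp: lessThan_Suc le_Suc_eq)
  qed (simp add: J)
  show "\<omega> ` {..<n} \<subseteq> {1..N + J n}"
  proof (induction n)
    case (Suc n)
    show ?case
      using Suc digit[of n] by (auto simp: lessThan_Suc)
  qed simp
qed

context full_branch_system
begin

text \<open>
Dividing the mass of a word by the power \<open>s\<close> of its length leaves at most the product of the \<open>cost\<close> of its
positions, \<open>1 / Z\<close> at a free one and \<open>1 / p a\<close> at one with planted digit \<open>a\<close>. The logarithm of the
product of the first \<open>n\<close> costs is at most \<open>J n * X n - n * ln Z\<close> with \<open>X n\<close> of order \<open>ln n\<close>, hence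
bounded. For the last digit the weight is compared with \<open>p a\<close> in place of \<open>p a powr s\<close>, which loses a constant
\<open>H\<close> as only the finitely many free digits matter.
\<close>

lemma planted_mass_compare:
  fixes J :: "nat \<Rightarrow> nat"
  assumes s: "0 < s" "s < 1" and N: "1 \<le> N" and Z: "1 < (\<Sum>a = 1..N. p a powr s)"
    and J: "J 0 = 0" "\<And>n. J (Suc n) = J n \<or> J (Suc n) = Suc (J n)"
    and lim: "(\<lambda>n. real (J n) / real n powr \<beta>) \<longlonglongrightarrow> c" and "\<beta> < 1"
    and C: "0 < C" "0 \<le> M" "\<And>k. k \<ge> 1 \<Longrightarrow> C * real k powr (- M) \<le> p k"
  shows "\<exists>K. \<forall>v a. 0 \<notin> set (v @ [a]) \<longrightarrow>
    word_mass (planted_weight (\<lambda>a. p a powr s) N J) (v @ [a])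
      \<le> K * cyl_length (v @ [a]) * cyl_length v powr (s - 1)"
proof -
  define Z where "Z = (\<Sum>a = 1..N. p a powr s)"
  define q where "q = planted_weight (\<lambda>a. p a powr s) N J"
  define cost where "cost i = (if J (Suc i) = J i then 1 / Z else 1 / p (N + J (Suc i)))" for i
  define H where "H = (\<Sum>a = 1..N. 1 / p a)"
  have Z: "1 < Z" using assms by (simp add: Z_def)
  have p: "0 < p a" "p a \<le> 1" if "a \<ge> 1" for a
    using p_pos[OF that] p_le_1[OF that] by auto
  have p_s: "p a \<le> p a powr s" "p a powr s \<le> 1" if "a \<ge> 1" for a
    using powr_mono'[of s 1 "p a"] powr_le1[of s "p a"] p[OF that] s by auto
  have H: "1 / p a \<le> H" if "a \<in> {1..N}" for a
    unfolding H_def using that p by (intro member_le_sum) (auto intro: less_imp_le)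
  have "1 \<le> 1 / p 1"
    using p[of 1] by simp
  also have "\<dots> \<le> H"
    using H[of 1] N by simp
  finally have "1 \<le> H" .
  have cost_pos: "0 < cost i" for i
    using Z p[of "N + J (Suc i)"] N by (auto simp: cost_def)
  have cost_nonneg: "0 \<le> cost i" for i
    using cost_pos by (rule less_imp_le)
  have q_eq: "q i a =
      (if J (Suc i) = J i then (if a \<in> {1..N} then p a powr s / Z else 0)
       else (if a = N + J (Suc i) then 1 else 0))" for i a
    by (simp only: q_def planted_weight_def Z_def)
  have q_nonneg: "0 \<le> q i a" for i a
    using Z by (simp add: q_eq)
  have q_le: "q i a \<le> cost i * p a powr s" if "a \<ge> 1" for i a
  proof (cases "J (Suc i) = J i")
    case True
    then show ?thesis using Z by (simp add: q_eq cost_def)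
  next
    case False
    have "1 \<le> p a powr s / p a"
      using p[OF that] p_s[OF that] by simp
    then show ?thesis
      using False p[of "N + J (Suc i)"] N by (auto simp: q_eq cost_def)
  qed
  have q_le': "q i a \<le> H * cost i * p a" if "a \<ge> 1" for i a
  proof (cases "J (Suc i) = J i")
    case True
    have "p a powr s / Z \<le> H * (1 / Z) * p a" if "a \<in> {1..N}"
      using H[OF that] p[of a] p_s[of a] Z that by (simp add: field_simps)
    moreover have "0 \<le> H * (1 / Z) * p a"
      using \<open>1 \<le> H\<close> Z p[OF that] by simp
    ultimately show ?thesis
      using True by (simp add: q_eq cost_def)
  next
    case False
    then show ?thesis
      using \<open>1 \<le> H\<close> p[OF that] p[of "N + J (Suc i)"] N
      by (auto simp: q_eq cost_def)
  qed
  have mass: "word_mass q v \<le> (\<Prod>i<length v. cost i) * cyl_length v powr s" if "0 \<notin> set v" for v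
    using that
  proof (induction v rule: rev_induct)
    case (snoc a v)
    then have a: "a \<ge> 1" by auto
    have v: "0 < cyl_length v" using snoc by (intro cyl_length_pos) auto
    have "word_mass q v * q (length v) a
        \<le> ((\<Prod>i<length v. cost i) * cyl_length v powr s) * (cost (length v) * p a powr s)"
      using snoc q_le[OF a] q_nonneg
      by (intro mult_mono) (auto intro!: mult_nonneg_nonneg prod_nonneg simp: cost_nonneg)
    then show ?case
      using v p[OF a] by (simp add: word_mass_snoc powr_mult mult_ac)
  qed simp
  \<comment> \<open>\<open>X n\<close> bounds the logarithm of the cost of one planted digit among the first \<open>n\<close>
    positions, relative to that of a free position.\<close>
  define X where "X n = (ln Z - ln C) + M * ln (real N + real n)" for n :: nat
  have X: "X n \<le> X (Suc n)" "ln Z - ln (p (N + j)) \<le> X n" if "j \<le> n" for n j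
  proof -
    show "X n \<le> X (Suc n)"
      unfolding X_def using C N by (intro add_left_mono mult_left_mono) auto
    have "ln C - M * ln (real N + real j) = ln (C * real (N + j) powr (- M))"
      using C N by (simp add: ln_mult ln_powr)
    also have "\<dots> \<le> ln (p (N + j))"
      using C(1) C(3)[of "N + j"] p[of "N + j"] N by (subst ln_le_cancel_iff) auto
    finally have "ln C - M * ln (real N + real j) \<le> ln (p (N + j))" .
    moreover have "M * ln (real N + real j) \<le> M * ln (real N + real n)"
      using C N that by (intro mult_left_mono) auto
    ultimately show "ln Z - ln (p (N + j)) \<le> X n"
      by (simp add: X_def)
  qed
  have J_le: "J n \<le> n" for n
  proof (induction n)
    case (Suc n)
    then show ?case using J(2)[of n] by linarith
  qed (simp add: J)
  have cost_le: "(\<Prod>i<n. cost i) \<le> exp (real (J n) * X n - real n * ln Z)" for n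
  proof (induction n)
    case (Suc n)
    have "real (J n) * X n \<le> real (J n) * X (Suc n)"
      using X(1)[of 0 n] by (intro mult_left_mono) auto
    moreover have "ln (cost n) \<le> (real (J (Suc n)) - real (J n)) * X (Suc n) - ln Z"
    proof (cases "J (Suc n) = J n")
      case True
      then show ?thesis using Z by (simp add: cost_def ln_div)
    next
      case False
      then have "J (Suc n) = Suc (J n)" using J(2)[of n] by simp
      then show ?thesis
        using X(2)[of "J (Suc n)" "Suc n"] J_le[of "Suc n"] p[of "N + J (Suc n)"] N
        by (simp add: cost_def ln_div)
    qed
    ultimately have "real (J n) * X n - real n * ln Z + ln (cost n)
        \<le> real (J (Suc n)) * X (Suc n) - real (Suc n) * ln Z"
      by (simp add: algebra_simps)
    then have "exp (real (J n) * X n - real n * ln Z) * cost n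
        \<le> exp (real (J (Suc n)) * X (Suc n) - real (Suc n) * ln Z)"
      using cost_pos[of n] by (metis exp_add exp_le_cancel_iff exp_ln)
    moreover have "(\<Prod>i<n. cost i) * cost n \<le> exp (real (J n) * X n - real n * ln Z) * cost n"
      using Suc cost_pos[of n] by (intro mult_right_mono) auto
    ultimately show ?case by simp
  qed (simp add: J)
  obtain B where B: "\<And>n. real (J n) * X n - real n * ln Z \<le> B"
    unfolding X_def using sublinear_log_cost_bounded[OF lim \<open>\<beta> < 1\<close>, of "ln Z"] Z
    by (metis ln_gt_zero)
  have "word_mass q (v @ [a]) \<le> (H * exp B) * cyl_length (v @ [a]) * cyl_length v powr (s - 1)"
    if no0: "0 \<notin> set (v @ [a])" for v a
  proof -
    have a: "a \<ge> 1" and v: "0 < cyl_length v"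
      using no0 by (auto intro: cyl_length_pos)
    have "word_mass q (v @ [a]) = word_mass q v * q (length v) a"
      by (rule word_mass_snoc)
    also have "\<dots> \<le> ((\<Prod>i<length v. cost i) * cyl_length v powr s) * (H * cost (length v) * p a)"
      using mass[of v] no0 q_le'[OF a] q_nonneg
      by (intro mult_mono) (auto intro!: mult_nonneg_nonneg prod_nonneg simp: cost_nonneg)
    also have "\<dots> = (\<Prod>i<Suc (length v). cost i) * (H * cyl_length v powr s * p a)"
      by simp
    also have "\<dots> \<le> exp B * (H * cyl_length v powr s * p a)"
      using cost_le[of "Suc (length v)"] B[of "Suc (length v)"] \<open>1 \<le> H\<close> p[OF a]
      by (intro mult_right_mono) (auto intro: order_trans)
    also have "cyl_length v powr s = cyl_length v powr (s - 1) * cyl_length v"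
      using v by (simp add: powr_diff)
    finally show ?thesis
      by (simp add: mult_ac)
  qed
  then show ?thesis
    unfolding q_def by blast
qed

text \<open>
The planted digits alone make the sequence take infinitely many values, so that it is realised by a point.
\<close>

lemma planted_point:
  fixes J :: "nat \<Rightarrow> nat" and \<omega> :: "nat \<Rightarrow> nat"
  assumes J: "J 0 = 0" "\<And>n. J (Suc n) = J n \<or> J (Suc n) = Suc (J n)"
    and lim: "(\<lambda>n. real (J n) / real n powr \<beta>) \<longlonglongrightarrow> c" and "0 < \<beta>" "0 < c"
    and pos: "\<And>i. 0 < planted_weight f N J i (\<omega> i)"
  shows "\<exists>x\<in>{x \<in> {0..<1}. (\<lambda>n. real (distinct_digits p I n x) / real n powr \<beta>) \<longlonglongrightarrow> c}.
    \<forall>n. x \<in> cylinder (map \<omega> [0..<n])"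
proof -
  note digits = planted_digits[of J f N \<omega>, OF J pos]
  have nz: "\<omega> i \<noteq> 0" for i
    using digits(2)[of "Suc i"] by fastforce
  have powr_top: "filterlim (\<lambda>n. real n powr \<beta>) at_top sequentially"
    using \<open>0 < \<beta>\<close> by real_asymp
  have "filterlim (\<lambda>n. real (J n) / real n powr \<beta> * real n powr \<beta>) at_top sequentially"
    using lim \<open>0 < c\<close> powr_top by (rule filterlim_tendsto_pos_mult_at_top)
  moreover have "\<forall>\<^sub>F n in sequentially. real (J n) / real n powr \<beta> * real n powr \<beta> = real (J n)"
    using eventually_gt_at_top[of 0] by eventually_elim simp
  ultimately have J_top: "filterlim (\<lambda>n. real (J n)) at_top sequentially"
    using filterlim_cong by force
  have "infinite (range \<omega>)"
  proof
    assume fin: "finite (range \<omega>)"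
    have "real (J n) \<le> real (card (range \<omega>))" for n
    proof -
      have "card {N<..N + J n} \<le> card (range \<omega>)"
        using digits(1)[of n] fin by (intro card_mono) auto
      then show ?thesis by simp
    qed
    moreover have "\<forall>\<^sub>F n in sequentially. real (card (range \<omega>)) < real (J n)"
      using J_top unfolding filterlim_at_top_dense by blast
    ultimately show False
      by (auto simp: eventually_sequentially not_less[symmetric])
  qed
  then obtain x where x: "\<And>n. x \<in> cylinder (map \<omega> [0..<n])"
    using point_with_digits[of \<omega>] nz by blast
  have count: "distinct_digits p I n x = card (\<omega> ` {..<n})" for n
  proof -
    have "digit p I (Suc i) x = \<omega> i" for i
      using digit_cylinder[of "map \<omega> [0..<Suc i]" x i] x[of "Suc i"] nz
      by (auto simp: image_iff nth_append dest: sym)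
    then have "(\<lambda>i. digit p I i x) ` Suc ` {..<n} = \<omega> ` {..<n}"
      by (simp add: image_image)
    then show ?thesis
      by (simp add: distinct_digits_def image_Suc_lessThan)
  qed
  have bounds: "J n \<le> distinct_digits p I n x" "distinct_digits p I n x \<le> N + J n" for n
    using card_mono[OF _ digits(1)[of n]] card_mono[OF _ digits(2)[of n]] by (simp_all add: count)
  have "(\<lambda>n. real (distinct_digits p I n x) / real n powr \<beta>) \<longlonglongrightarrow> c"
  proof (rule tendsto_sandwich)
    show "\<forall>\<^sub>F n in sequentially. real (J n) / real n powr \<beta> \<le> real (distinct_digits p I n x) / real n powr \<beta>"
      using bounds(1) by (intro always_eventually allI divide_right_mono) auto
    show "\<forall>\<^sub>F n in sequentially. real (distinct_digits p I n x) / real n powr \<beta>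
        \<le> real N / real n powr \<beta> + real (J n) / real n powr \<beta>"
    proof (intro always_eventually allI)
      fix n
      have "real (distinct_digits p I n x) \<le> real N + real (J n)"
        using bounds(2)[of n] by linarith
      then show "real (distinct_digits p I n x) / real n powr \<beta>
        \<le> real N / real n powr \<beta> + real (J n) / real n powr \<beta>"
        by (simp add: divide_right_mono flip: add_divide_distrib)
    qed
    have "(\<lambda>n. real N / real n powr \<beta>) \<longlonglongrightarrow> 0"
      using \<open>0 < \<beta>\<close> by real_asymp
    from tendsto_add[OF this lim]
    show "(\<lambda>n. real N / real n powr \<beta> + real (J n) / real n powr \<beta>) \<longlonglongrightarrow> c"
      by simp
  qed (rule lim)
  moreover have "x \<in> {0..<1}"
    using x[of 0] by (simp add: cylinder_def)
  ultimately show ?thesis using x by blast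
qed

text \<open>
Stated for supersets so that it applies to sublinear growth as well.
\<close>

lemma hausdorff_dim_power_growth_ge_1:
  assumes "\<rho> \<ge> 1" "regularly_varying p \<rho>" and \<beta>: "0 < \<beta>" "\<beta> < 1" and c: "0 < c"
    and E: "{x \<in> {0..<1}. (\<lambda>n. real (distinct_digits p I n x) / real n powr \<beta>) \<longlonglongrightarrow> c} \<subseteq> E"
  shows "1 \<le> hausdorff_dim E"
  unfolding hausdorff_dim_def
proof (rule INF_greatest)
  fix t assume "t \<in> {t. 0 \<le> t \<and> hausdorff_measure t E = 0}"
  then have t: "0 \<le> t" "hausdorff_measure t E = 0" by auto
  have "1 \<le> t"
  proof (rule ccontr)
    assume "\<not> 1 \<le> t"
    define s where "s = max t (1 / 2)"
    have s: "0 < s" "s < 1" "t \<le> s"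
      using \<open>\<not> 1 \<le> t\<close> by (auto simp: s_def)
    obtain C M where C: "0 < C" "0 \<le> M" "\<And>k. k \<ge> 1 \<Longrightarrow> C * real k powr (- M) \<le> p k"
      using regularly_varying_lower_bound[of p \<rho>] p_pos assms by blast
    obtain N where N: "1 \<le> N" "1 < (\<Sum>a = 1..N. p a powr s)"
      using truncated_pressure_gt_1[OF s(1,2)] by blast
    obtain J where J: "J 0 = 0" "\<And>n. J (Suc n) = J n \<or> J (Suc n) = Suc (J n)"
      and lim: "(\<lambda>n. real (J n) / real n powr \<beta>) \<longlonglongrightarrow> c"
      using unit_step_counting_function[OF \<beta> c] by blast
    let ?q = "planted_weight (\<lambda>a. p a powr s) N J"
    obtain K where K: "\<And>v a. 0 \<notin> set (v @ [a]) \<Longrightarrow>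
        word_mass ?q (v @ [a]) \<le> K * cyl_length (v @ [a]) * cyl_length v powr (s - 1)"
      using planted_mass_compare[OF s(1,2) N J lim \<beta>(2) C] by blast
    have "hausdorff_measure t E \<noteq> 0"
    proof (rule hausdorff_measure_ne_0[where q = ?q and K = K and s = s])
      show "0 \<le> ?q i a" for i a
        using N by (simp add: planted_weight_def)
      show "?q i 0 = 0" for i
        using N by (simp add: planted_weight_def)
      show "?q i sums 1" for i
      proof (cases "J (Suc i) = J i")
        case True
        have "?q i sums (\<Sum>a\<in>{1..N}. ?q i a)"
          using True by (intro sums_finite) (auto simp: planted_weight_def)
        also have "(\<Sum>a\<in>{1..N}. ?q i a) = 1"
          using True N by (simp add: planted_weight_def flip: sum_divide_distrib)
        finally show ?thesis .
      next
        case False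
        then have "?q i = (\<lambda>a. if a = N + J (Suc i) then 1 else 0)"
          by (simp add: planted_weight_def fun_eq_iff)
        then show ?thesis
          using sums_single[of "N + J (Suc i)" "\<lambda>_. 1 :: real"] by simp
      qed
      show "\<exists>x\<in>E. \<forall>n. x \<in> cylinder (map \<omega> [0..<n])" if "\<And>n. 0 < ?q n (\<omega> n)" for \<omega>
        using planted_point[of J, OF J lim \<beta>(1) c that] E by blast
    qed (use s t K in auto)
    then show False using t by simp
  qed
  then show "1 \<le> ereal t" by simp
qed

end

theorem corollary1:
  fixes p :: "nat \<Rightarrow> real" and I :: "nat \<Rightarrow> real set" and \<rho> :: real
  assumes "probability_sequence p"
    and "interval_partition p I"
    and "\<rho> \<ge> 1"
    and "regularly_varying p \<rho>"
  shows "(\<forall>\<beta> c :: real. 0 < \<beta> \<longrightarrow> \<beta> < 1 \<longrightarrow> c > 0 \<longrightarrow>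
            hausdorff_dim {x \<in> {0..<1}.
              (\<lambda>n. real (distinct_digits p I n x) / real n powr \<beta>) \<longlonglongrightarrow> c} = 1) \<and>
         hausdorff_dim {x \<in> {0..<1}.
           (\<lambda>n. real (distinct_digits p I n x) / real n) \<longlonglongrightarrow> 0} = 1"
proof (intro conjI allI impI)
  interpret full_branch_system p I
    by standard (fact assms)+
  let ?D = "\<lambda>n x. real (distinct_digits p I n x)"
  show "hausdorff_dim {x \<in> {0..<1}. (\<lambda>n. ?D n x / real n powr \<beta>) \<longlonglongrightarrow> c} = 1"
    if "0 < \<beta>" "\<beta> < 1" "c > 0" for \<beta> c :: real
    using hausdorff_dim_power_growth_ge_1[OF assms(3,4) that order_refl]
    by (intro antisym hausdorff_dim_le_1) auto
  have "(\<lambda>n. ?D n x / real n) \<longlonglongrightarrow> 0" if "(\<lambda>n. ?D n x / real n powr (1 / 2)) \<longlonglongrightarrow> 1" for x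
  proof -
    have "(\<lambda>n. real n powr (- 1 / 2)) \<longlonglongrightarrow> 0"
      by real_asymp
    from tendsto_mult[OF that this]
    have "(\<lambda>n. ?D n x / real n powr (1 / 2) * real n powr (- 1 / 2)) \<longlonglongrightarrow> 0"
      by simp
    moreover have "?D n x / real n powr (1 / 2) * real n powr (- 1 / 2) = ?D n x / real n" for n
      by (simp add: powr_minus_divide flip: powr_add)
    ultimately show ?thesis by simp
  qed
  then have "1 \<le> hausdorff_dim {x \<in> {0..<1}. (\<lambda>n. ?D n x / real n) \<longlonglongrightarrow> 0}"
    by (intro hausdorff_dim_power_growth_ge_1[OF assms(3,4), of "1 / 2" 1]) auto
  then show "hausdorff_dim {x \<in> {0..<1}. (\<lambda>n. ?D n x / real n) \<longlonglongrightarrow> 0} = 1"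
    by (intro antisym hausdorff_dim_le_1) auto
qed

end
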